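(* Let $X$ be a compact uniform space with uniformity $\mathcal{U}$ and let $f : X \to X$ be a homeomorphism. Then $f$ is topologically expansive if and only if $f$ is orbit expansive.
   Context: A uniform space $(X,\mathcal{U})$ carries the topology in which a set $T\subseteq X$ is open iff for every $x\in T$ there is $U\in\mathcal{U}$ with $U[x]=\{y : (x,y)\in U\}\subseteq T$; topological terms refer to this topology, and compactness does not presuppose Hausdorff. Members of $\mathcal{U}$ are called entourages. For an entourage $D\in\mathcal{U}$ and $x\in X$, let $\Gamma_D(x,f)=\{y\in X : (f^n(x),f^n(y))\in D \text{ for all } n\in\mathbb{Z}\}$. A homeomorphism $f:X\to X$ is topologically expansive if there exists an entourage $A\in\mathcal{U}$ such that $\Gamma_A(x,f)=\{x\}$ for every $x\in X$. For a subset $A\subseteq X$ and a cover $\mathcal{A}$ of $X$, write $A\prec\mathcal{A}$ if there exists $C\in\mathcal{A}$ with $A\subseteq C$. A homeomorphism $f$ of a topological space $X$ is orbit expansive if there is a finite open cover $\mathcal{A}$ of $X$ such that, for all $x,y\in X$, if $\{f^n(x),f^n(y)\}\prec\mathcal{A}$ for every $n\in\mathbb{Z}$, then $x=y$. *)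

theory Defs
  imports "HOL-Analysis.Analysis"
begin

text \<open>A uniform space is a type of class \<^class>\<open>uniform_space\<close>. Its uniformity is
  given as a filter of predicates on pairs; the entourages are the sets belonging to that filter.
  The class axiom \<open>open_uniformity\<close> says that the topology is the one induced by the
  uniformity; no separation is assumed.\<close>

definition entourage :: "('a::uniform_space \<times> 'a) set \<Rightarrow> bool" where
  "entourage D \<longleftrightarrow> eventually (\<lambda>p. p \<in> D) uniformity"

text \<open>Meant for bijective \<open>f\<close>, where it is the \<open>n\<close>-th power of \<open>f\<close> in the group of bijections.\<close>

definition iterate_int :: "('a \<Rightarrow> 'a) \<Rightarrow> int \<Rightarrow> 'a \<Rightarrow> 'a" where
  "iterate_int f n = (if 0 \<le> n then f ^^ nat n else inv f ^^ nat (- n))"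

definition dynamical_ball :: "('a \<times> 'a) set \<Rightarrow> 'a \<Rightarrow> ('a \<Rightarrow> 'a) \<Rightarrow> 'a set" where
  "dynamical_ball D x f = {y. \<forall>n::int. (iterate_int f n x, iterate_int f n y) \<in> D}"

definition topologically_expansive :: "('a::uniform_space \<Rightarrow> 'a) \<Rightarrow> bool" where
  "topologically_expansive f \<longleftrightarrow>
     (\<exists>A. entourage A \<and> (\<forall>x. dynamical_ball A x f = {x}))"

definition subordinate :: "'a set \<Rightarrow> 'a set set \<Rightarrow> bool" where
  "subordinate A \<A> \<longleftrightarrow> (\<exists>C\<in>\<A>. A \<subseteq> C)"

definition orbit_expansive :: "('a::topological_space \<Rightarrow> 'a) \<Rightarrow> bool" where
  "orbit_expansive f \<longleftrightarrow>
     (\<exists>\<A>. finite \<A> \<and> (\<forall>C\<in>\<A>. open C) \<and> \<Union>\<A> = UNIV \<and>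
        (\<forall>x y. (\<forall>n::int. subordinate {iterate_int f n x, iterate_int f n y} \<A>) \<longrightarrow> x = y))"

end

theory Submission
  imports Defs
begin

text \<open>Both notions of expansiveness ask that two points coincide as soon as their orbits stay
  close at every time. They differ in how closeness is measured: by an entourage, or by a finite
  open cover. On a compact space the two scales are interchangeable. Each
  entourage \<open>A\<close> admits a finite open cover with \<open>C \<times> C \<subseteq> A\<close> for all its members
  (\<open>finite_open_cover_subordinate_to_entourage\<close>). Conversely, each open cover has a Lebesgue
  entourage, whose pairs each lie in a single member of the cover (\<open>Lebesgue_entourage\<close>).
  Trading one scale for the other turns each kind of expansiveness into the other. The only
  remaining point is that dynamical balls contain their centres, because entourages contain
  the diagonal.

  Both exchanges rest on the same compactness argument: choose an entourage \<open>E\<close> at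
  each point \<open>x\<close>, and cover the space by finitely many of the neighbourhoods \<open>E[x]\<close>.\<close>

lemma eventually_nhds_entourage_section:
  fixes x :: "'a::uniform_space"
  assumes "eventually (\<lambda>(y, z). P y z) uniformity"
  shows "eventually (P x) (nhds x)"
  unfolding eventually_nhds_uniformity by (rule eventually_mono[OF assms]) auto

text \<open>The section \<open>E[x]\<close> need not be open, so the cover consists of open
  neighbourhoods of \<open>x\<close> inside \<open>E[x]\<close>. The indexing by points lets the entourage vary with
  the point, which the Lebesgue argument requires.\<close>

lemma compact_finite_subcover_by_sections:
  fixes E :: "'a::uniform_space \<Rightarrow> 'a \<Rightarrow> 'a \<Rightarrow> bool"
  assumes "compact (UNIV :: 'a set)"
    and "\<And>x. eventually (\<lambda>(y, z). E x y z) uniformity"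
  obtains K N where "finite K" "\<forall>x. open (N x)" "\<forall>x. \<forall>z\<in>N x. E x x z"
    "(\<Union>x\<in>K. N x) = UNIV"
proof -
  have "\<exists>N. open N \<and> x \<in> N \<and> (\<forall>z\<in>N. E x x z)" for x
    using eventually_nhds_entourage_section[OF assms(2), of x x]
    unfolding eventually_nhds by blast
  then obtain N where N: "\<And>x. open (N x)" "\<And>x. x \<in> N x" "\<And>x z. z \<in> N x \<Longrightarrow> E x x z"
    by metis
  from N(2) have "(UNIV :: 'a set) \<subseteq> (\<Union>x\<in>UNIV. N x)" by blast
  from compactE_image[OF assms(1) N(1) this]
  obtain K where K: "finite K" "UNIV \<subseteq> (\<Union>x\<in>K. N x)" by metis
  show thesis
    by (rule that[OF K(1), of N]) (use N K(2) in auto)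
qed

text \<open>For \<open>E\<close> symmetric with \<open>E \<circ> E \<subseteq> A\<close>, two points of \<open>E[x]\<close> are
  related by \<open>A\<close> through \<open>x\<close>; so finitely many such sections suffice.\<close>

lemma finite_open_cover_subordinate_to_entourage:
  fixes A :: "('a::uniform_space \<times> 'a) set"
  assumes "compact (UNIV :: 'a set)" and "entourage A"
  obtains \<C> where "finite \<C>" "\<forall>C\<in>\<C>. open C" "\<Union>\<C> = UNIV" "\<forall>C\<in>\<C>. C \<times> C \<subseteq> A"
proof -
  obtain D where D: "eventually D uniformity"
    "\<And>x y z. D (x, y) \<Longrightarrow> D (y, z) \<Longrightarrow> (x, z) \<in> A"
    using uniformity_transE[OF assms(2)[unfolded entourage_def]] by blast
  have D_sym: "eventually (\<lambda>(y, z). D (y, z) \<and> D (z, y)) uniformity"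
    using eventually_conj[OF D(1) uniformity_sym[OF D(1)]] by (simp add: case_prod_unfold)
  obtain K N where N: "finite K" "\<forall>x. open (N x)" "\<forall>x. \<forall>z\<in>N x. D (x, z) \<and> D (z, x)"
    "(\<Union>x\<in>K. N x) = UNIV"
    by (rule compact_finite_subcover_by_sections[OF assms(1),
          of "\<lambda>_ y z. D (y, z) \<and> D (z, y)", OF D_sym])
  have "N x \<times> N x \<subseteq> A" for x
    using N(3) D(2) by blast
  with N show thesis
    by (intro that[of "N ` K"]) auto
qed

text \<open>This is the uniform form of the Lebesgue number lemma. At each \<open>x\<close>, pick
  \<open>E x\<close> with \<open>(E x \<circ> E x)[x]\<close> inside a member of the cover. If finitely many
  sections \<open>E x[x]\<close> cover the space, the intersection of those \<open>E x\<close> is a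
  Lebesgue entourage: when \<open>y\<close> lies in \<open>E x[x]\<close>, both \<open>y\<close> and any
  \<open>z\<close> related to it are reached from \<open>x\<close> in two steps.\<close>

lemma Lebesgue_entourage:
  fixes \<C> :: "'a::uniform_space set set"
  assumes "compact (UNIV :: 'a set)" and "\<forall>C\<in>\<C>. open C" and "\<Union>\<C> = UNIV"
  obtains A where "entourage A" "\<forall>(y, z)\<in>A. subordinate {y, z} \<C>"
proof -
  have "\<exists>C E. C \<in> \<C> \<and> eventually E uniformity \<and> (\<forall>y z. E (x, y) \<longrightarrow> E (y, z) \<longrightarrow> z \<in> C)" for x
  proof -
    obtain C where C: "C \<in> \<C>" "x \<in> C"
      using UNIV_I[of x] unfolding assms(3)[symmetric] by (rule UnionE)
    then have "eventually (\<lambda>y. y \<in> C) (nhds x)"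
      using assms(2) by (auto intro: eventually_nhds_in_open)
    then have "eventually (\<lambda>(x', y). x' = x \<longrightarrow> y \<in> C) uniformity"
      by (simp only: eventually_nhds_uniformity)
    from uniformity_transE[OF this] obtain E where
      "eventually E uniformity" "\<And>x' y z. E (x', y) \<Longrightarrow> E (y, z) \<Longrightarrow> x' = x \<longrightarrow> z \<in> C"
      by auto
    with C(1) show ?thesis by (intro exI[of _ C] exI[of _ E]) simp
  qed
  then obtain C E where CE: "\<And>x. C x \<in> \<C>" "\<And>x. eventually (E x) uniformity"
    "\<And>x y z. E x (x, y) \<Longrightarrow> E x (y, z) \<Longrightarrow> z \<in> C x"
    by metis
  have E_curried: "eventually (\<lambda>(y, z). E x (y, z)) uniformity" for x
    using CE(2) by simp
  obtain K N where N: "finite K" "\<forall>x. open (N x)" "\<forall>x. \<forall>z\<in>N x. E x (x, z)"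
    "(\<Union>x\<in>K. N x) = UNIV"
    by (rule compact_finite_subcover_by_sections[OF assms(1),
          of "\<lambda>x y z. E x (y, z)", OF E_curried])
  define A where "A = {p. \<forall>x\<in>K. E x p}"
  have "entourage A"
    unfolding entourage_def A_def using N(1) CE(2) by (simp add: eventually_ball_finite)
  moreover have "subordinate {y, z} \<C>" if "(y, z) \<in> A" for y z
  proof -
    obtain x where x: "x \<in> K" "y \<in> N x"
      using UNIV_I[of y] unfolding N(4)[symmetric] by (rule UN_E)
    have "E x (y, z)" using that x(1) by (simp add: A_def)
    have "E x (x, y)" using N(3) x(2) by blast
    then have "y \<in> C x" "z \<in> C x"
      using CE(3) uniformity_refl[OF CE(2)] \<open>E x (y, z)\<close> by auto
    then show ?thesis using CE(1) unfolding subordinate_def by blast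
  qed
  ultimately show thesis by (intro that) auto
qed

lemma centre_in_dynamical_ball:
  assumes "entourage A"
  shows "x \<in> dynamical_ball A x f"
  using uniformity_refl[OF assms[unfolded entourage_def]] by (simp add: dynamical_ball_def)

theorem proposition3p9:
  fixes f :: "'a::uniform_space \<Rightarrow> 'a"
  assumes "compact (UNIV :: 'a set)"
    and "homeomorphism UNIV UNIV f (inv f)"
  shows "topologically_expansive f \<longleftrightarrow> orbit_expansive f"
proof
  assume "topologically_expansive f"
  then obtain A where A: "entourage A" "\<And>x. dynamical_ball A x f = {x}"
    unfolding topologically_expansive_def by blast
  obtain \<C> where \<C>: "finite \<C>" "\<forall>C\<in>\<C>. open C" "\<Union>\<C> = UNIV" "\<forall>C\<in>\<C>. C \<times> C \<subseteq> A"
    by (rule finite_open_cover_subordinate_to_entourage[OF assms(1) A(1)])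
  have "x = y" if "\<forall>n. subordinate {iterate_int f n x, iterate_int f n y} \<C>" for x y
  proof -
    have "(iterate_int f n x, iterate_int f n y) \<in> A" for n
      using that \<C>(4) unfolding subordinate_def by blast
    then have "y \<in> dynamical_ball A x f" by (simp add: dynamical_ball_def)
    with A(2) show ?thesis by simp
  qed
  with \<C>(1-3) show "orbit_expansive f" unfolding orbit_expansive_def by blast
next
  assume "orbit_expansive f"
  then obtain \<C> where \<C>: "\<forall>C\<in>\<C>. open C" "\<Union>\<C> = UNIV"
    "\<And>x y. \<forall>n. subordinate {iterate_int f n x, iterate_int f n y} \<C> \<Longrightarrow> x = y"
    unfolding orbit_expansive_def by metis
  obtain A where A: "entourage A" "\<forall>(y, z)\<in>A. subordinate {y, z} \<C>"
    by (rule Lebesgue_entourage[OF assms(1) \<C>(1,2)])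
  have "y = x" if "y \<in> dynamical_ball A x f" for x y
    using that A(2) by (intro \<C>(3)[symmetric]) (auto simp: dynamical_ball_def)
  with centre_in_dynamical_ball[OF A(1)] have "dynamical_ball A x f = {x}" for x
    by blast
  with A(1) show "topologically_expansive f" unfolding topologically_expansive_def by blast
qed

end
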